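(* Let $M\in\mathbb{R}^{[n]^2\times[n]^2}$ be a degree-4 SoS-symmetric matrix satisfying $\|M\|_{S_1}\le1$ and $\|M_{3,1}\|_{S_1}\le1$. Then for any $q$ divisible by $4$, \[\bigl\|(M^{\otimes q/4})^S\bigr\|_{S_1}=2^{O(q)}.\]
   Context: $\|\cdot\|_{S_1}$ is the Schatten 1-norm (nuclear norm, sum of singular values). $M$ is degree-4 SoS-symmetric if $M[(i_1,i_2),(i_3,i_4)]$ depends only on the multiset $\{i_1,i_2,i_3,i_4\}$. Let $T\in\mathbb{R}^{[n]^4}$, $T[i_1,i_2,i_3,i_4]=M[(i_1,i_2),(i_3,i_4)]$; for non-negative integers $x+y=4$, $M_{x,y}\in\mathbb{R}^{[n]^x\times[n]^y}$ is given by $M_{x,y}[(i_1,\dots,i_x),(j_1,\dots,j_y)]=T[i_1,\dots,i_x,j_1,\dots,j_y]$. $M^{\otimes q/4}\in\mathbb{R}^{[n]^{q/2}\times[n]^{q/2}}$ is the $q/4$-fold Kronecker power. For $B\in\mathbb{R}^{[n]^{q/2}\times[n]^{q/2}}$, view entries as indexed by $K=(k_1,\dots,k_q)\in[n]^q$ (row index first $q/2$ coordinates, column index last $q/2$); for $\pi\in\mathbb{S}_q$, $B^\pi[K]:=B[(k_{\pi(1)},\dots,k_{\pi(q)})]$, and the symmetrization is $B^S:=\frac1{q!}\sum_{\pi\in\mathbb{S}_q}B^\pi$ (equivalently, $B^S[I,J]$ is the average of $B[I',J']$ over all $(I',J')$ whose concatenation is a rearrangement of the concatenation of $(I,J)$).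 *)

theory Defs
  imports
    "HOL-Combinatorics.Permutations"
    "Jordan_Normal_Form.Char_Poly"
begin

text \<open>Singular values are listed with multiplicity.  For a matrix with more columns than rows the
  list is padded with zeros, which do not affect the sum.\<close>

definition singular_values :: "real mat \<Rightarrow> real multiset" where
  "singular_values A = image_mset sqrt (proots (char_poly (transpose_mat A * A)))"

definition schatten1_norm :: "real mat \<Rightarrow> real" where
  "schatten1_norm A = sum_mset (singular_values A)"

text \<open>The index set \<open>[n]\<close> is \<open>{..<n}\<close>, and a multi-index in \<open>[n]\<^sup>x\<close> is a list of length \<open>x\<close>.
  A matrix with rows \<open>[n]\<^sup>x\<close> and columns \<open>[n]\<^sup>y\<close> is given by its entry function; values of the function
  outside these index sets are irrelevant.\<close>

type_synonym tmatrix = "nat list \<Rightarrow> nat list \<Rightarrow> real"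

definition tuples :: "nat \<Rightarrow> nat \<Rightarrow> nat list set" where
  "tuples n x = {K. length K = x \<and> set K \<subseteq> {..<n}}"

text \<open>\<open>List.n_lists x [0..<n]\<close> enumerates \<open>tuples n x\<close> without repetition; its length is \<open>n ^ x\<close>.\<close>

definition to_mat :: "nat \<Rightarrow> nat \<Rightarrow> nat \<Rightarrow> tmatrix \<Rightarrow> real mat" where
  "to_mat n x y F = mat (n ^ x) (n ^ y)
     (\<lambda>(i, j). F (List.n_lists x [0..<n] ! i) (List.n_lists y [0..<n] ! j))"

definition tensor_of :: "tmatrix \<Rightarrow> nat list \<Rightarrow> real" where
  "tensor_of M K = M (take 2 K) (drop 2 K)"

definition sos_symmetric4 :: "nat \<Rightarrow> tmatrix \<Rightarrow> bool" where
  "sos_symmetric4 n M \<longleftrightarrow>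
     (\<forall>K \<in> tuples n 4. \<forall>L \<in> tuples n 4. mset K = mset L \<longrightarrow> tensor_of M K = tensor_of M L)"

text \<open>The matrix \<open>M\<^bsub>x,y\<^esub>\<close>; the pair \<open>(x, y)\<close> with \<open>x + y = 4\<close> is determined by the lengths of the
  row and column multi-indices at which it is evaluated.\<close>

definition reshape :: "tmatrix \<Rightarrow> tmatrix" where
  "reshape M I J = tensor_of M (I @ J)"

text \<open>Kronecker product whose first factor has rows \<open>[n]\<^sup>a\<close> and columns \<open>[n]\<^sup>b\<close>.\<close>

definition kronecker :: "nat \<Rightarrow> nat \<Rightarrow> tmatrix \<Rightarrow> tmatrix \<Rightarrow> tmatrix" where
  "kronecker a b F G I J = F (take a I) (take b J) * G (drop a I) (drop b J)"

primrec kronecker_power :: "tmatrix \<Rightarrow> nat \<Rightarrow> tmatrix" where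
  "kronecker_power M 0 = (\<lambda>I J. 1)"
| "kronecker_power M (Suc k) = kronecker 2 2 M (kronecker_power M k)"

text \<open>\<open>permute_list \<pi> K\<close> has \<open>i\<close>-th entry \<open>K ! \<pi> i\<close>.\<close>

definition permute_entries :: "(nat \<Rightarrow> nat) \<Rightarrow> tmatrix \<Rightarrow> tmatrix" where
  "permute_entries \<pi> B I J =
     (let K = permute_list \<pi> (I @ J) in B (take (length I) K) (drop (length I) K))"

definition symmetrization :: "nat \<Rightarrow> tmatrix \<Rightarrow> tmatrix" where
  "symmetrization q B I J = (\<Sum>\<pi> | \<pi> permutes {..<q}. permute_entries \<pi> B I J) / fact q"

end

theory Submission
  imports Defs "Jordan_Normal_Form.Spectral_Radius" "HOL-Analysis.L2_Norm"
begin

text \<open>The nuclear norm is the projective norm: \<open>\<parallel>F\<parallel> \<le> c\<close> iff \<open>F\<close> is a sum of rank-one matrices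
  \<open>u\<^sub>i v\<^sub>i\<^sup>T\<close> with \<open>\<Sum> \<bar>u\<^sub>i\<bar> \<bar>v\<^sub>i\<bar> \<le> c\<close>.  In this form subadditivity, multiplicativity under Kronecker
  products and invariance under reindexing of rows and columns are immediate.  Each permuted copy of
  the Kronecker power is, up to reindexing, a Kronecker product of matrices \<open>M\<^bsub>x,4-x\<^esub>\<close>, because a
  permutation only decides which of the four indices of each factor become row indices.
  All of these factors have norm at most 1: \<open>M\<^bsub>2,2\<^esub>\<close>, \<open>M\<^bsub>3,1\<^esub>\<close> and its transpose by assumption, and
  \<open>M\<^bsub>4,0\<^esub>\<close> and its transpose because their norm is the Frobenius norm of \<open>M\<close>.  Averaging over
  permutations even gives the bound 1, so that \<open>C = 0\<close> suffices.\<close>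

subsection \<open>Diagonalization of real symmetric matrices\<close>

text \<open>A complex eigenvector \<open>z\<close> exists, and evaluating the Hermitian form of
  \<open>A\<close> at \<open>z\<close> in two ways forces its eigenvalue \<open>l\<close> to equal
  \<open>cnj l\<close>. As \<open>char_poly A\<close> has real coefficients, \<open>Re l\<close> is
  then a root of it over the reals.\<close>

lemma real_symmetric_eigenvalue:
  fixes A :: "real mat"
  assumes A: "A \<in> carrier_mat n n" and sym: "transpose_mat A = A" and n: "n \<noteq> 0"
  shows "\<exists>r. eigenvalue A r"
proof -
  let ?A = "map_mat complex_of_real A"
  have cA: "?A \<in> carrier_mat n n" using A by simp
  from spectrum_non_empty[OF cA] n obtain l where l: "eigenvalue ?A l"
    unfolding spectrum_def by auto
  then obtain z where z: "z \<in> carrier_vec n" "z \<noteq> 0\<^sub>v n" and Az: "?A *\<^sub>v z = l \<cdot>\<^sub>v z"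
    using cA unfolding eigenvalue_def eigenvector_def by auto
  have zc: "conjugate z \<in> carrier_vec n" using z by auto
  have conjA: "?A *\<^sub>v conjugate z = conjugate (?A *\<^sub>v z)"
    by (rule eq_vecI) (use A z in \<open>auto simp: scalar_prod_def conjugate_complex_def\<close>)
  have "(?A *\<^sub>v z) \<bullet>c z = z \<bullet> (?A *\<^sub>v conjugate z)"
  proof -
    have "transpose_mat ?A = ?A" using sym by (metis map_mat_transpose)
    with transpose_vec_mult_scalar[OF cA zc z(1)]
    show ?thesis using cA z zc by simp
  qed
  also have "\<dots> = z \<bullet>c (l \<cdot>\<^sub>v z)" by (simp add: conjA Az)
  finally have "l * (z \<bullet>c z) = cnj l * (z \<bullet>c z)"
    using z zc unfolding Az by (simp add: conjugate_smult_vec conjugate_complex_def)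
  moreover have "z \<bullet>c z \<noteq> 0" using conjugate_square_eq_0_vec[OF z(1)] z(2) by auto
  ultimately have "cnj l = l" by simp
  then have "l = complex_of_real (Re l)" by (simp add: complex_eq_iff)
  then have "poly (map_poly complex_of_real (char_poly A)) (of_real (Re l)) = 0"
    using l eigenvalue_root_char_poly[OF cA] of_real_hom.char_poly_hom[OF A, where 'a=complex] by metis
  then have "poly (char_poly A) (Re l) = 0" by simp
  then show ?thesis using eigenvalue_root_char_poly[OF A] by blast
qed

text \<open>The witness is the Householder reflection exchanging \<open>v\<close> and the first unit vector.\<close>

lemma orthogonal_mat_first_col:
  fixes v :: "real vec"
  assumes v: "v \<in> carrier_vec n" and n: "n \<noteq> 0" and vv: "v \<bullet> v = 1"
  shows "\<exists>H \<in> carrier_mat n n. transpose_mat H = H \<and> H * H = 1\<^sub>m n \<and> col H 0 = v"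
proof (cases "v = unit_vec n 0")
  case True
  then show ?thesis using n by (intro bexI[of _ "1\<^sub>m n"]) auto
next
  case False
  define w where "w = v - unit_vec n 0"
  have w: "w \<in> carrier_vec n" using v by (simp add: w_def)
  have wi: "w $ i = v $ i - (if i = 0 then 1 else 0)" if "i < n" for i
    using that n v by (simp add: w_def)
  have w0: "w \<noteq> 0\<^sub>v n"
  proof
    assume "w = 0\<^sub>v n"
    then have "v = unit_vec n 0"
      using v n wi by (intro eq_vecI) (fastforce simp: unit_vec_def)+
    with False show False by simp
  qed
  define s where "s = (\<Sum>i<n. w $ i * w $ i)"
  have s: "s = w \<bullet> w" using w by (simp add: s_def scalar_prod_def lessThan_atLeast0)
  have s0: "s \<noteq> 0" using w0 w conjugate_square_eq_0_vec[OF w] by (simp add: s)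
  \<comment> \<open>Both \<open>v\<close> and the first unit vector have length 1, so the squared
    length of their difference is linear in \<open>v $ 0\<close>. This is what makes the reflection
    map the first unit vector to \<open>v\<close>.\<close>
  have "s = (\<Sum>i<n. v $ i * v $ i - 2 * (if i = 0 then v $ i else 0) + (if i = 0 then 1 else 0))"
    unfolding s_def by (rule sum.cong) (auto simp: wi algebra_simps)
  also have "\<dots> = 2 - 2 * v $ 0"
    using vv v n by (simp add: sum.distrib sum_subtractf scalar_prod_def lessThan_atLeast0
        flip: sum_distrib_left)
  finally have sv: "s = - 2 * w $ 0" using wi[of 0] n by simp
  define H where "H = mat n n (\<lambda>(i, j). (if i = j then 1 else 0) - 2 / s * w $ i * w $ j)"
  have H: "H \<in> carrier_mat n n" by (simp add: H_def)
  have "transpose_mat H = H" by (rule eq_matI) (auto simp: H_def)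
  moreover have "H * H = 1\<^sub>m n"
  proof (rule eq_matI)
    fix i j assume "i < dim_row (1\<^sub>m n :: real mat)" "j < dim_col (1\<^sub>m n :: real mat)"
    then have ij: "i < n" "j < n" by auto
    have "(H * H) $$ (i, j) = (\<Sum>k<n. H $$ (i, k) * H $$ (k, j))"
      using H ij by (simp add: scalar_prod_def lessThan_atLeast0)
    \<comment> \<open>The terms at \<open>k = i\<close> and \<open>k = j\<close> contribute
      \<open>- 2 / s * w $ i * w $ j\<close> each. The squares of \<open>w\<close> add up to
      \<open>s\<close>, so the last term contributes \<open>4 / s * w $ i * w $ j\<close> and
      cancels them.\<close>
    also have "\<dots> = (\<Sum>k<n. (if k = i then (if i = j then 1 else 0) - 2 / s * w $ i * w $ j else 0)
        - (if k = j then 2 / s * w $ i * w $ j else 0)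
        + (4 / (s * s) * w $ i * w $ j) * (w $ k * w $ k))"
      by (rule sum.cong) (use ij s0 in \<open>auto simp: H_def field_simps\<close>)
    also have "\<dots> = (if i = j then 1 else 0) - 4 / s * w $ i * w $ j
        + 4 / (s * s) * w $ i * w $ j * s"
      unfolding sum.distrib sum_subtractf sum_distrib_left[symmetric] s_def[symmetric]
      using ij by simp
    finally show "(H * H) $$ (i, j) = 1\<^sub>m n $$ (i, j)" using ij s0 by simp
  qed (use H in auto)
  moreover have "col H 0 = v"
  proof (rule eq_vecI)
    fix i assume "i < dim_vec v"
    then have i: "i < n" using v by simp
    have "2 / s * w $ i * w $ 0 = - (w $ i)" using sv s0 by (simp add: field_simps)
    then show "col H 0 $ i = v $ i" using i n by (simp add: H_def wi)
  qed (use v H in auto)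
  ultimately show ?thesis using H by blast
qed

text \<open>Deflation: a reflection moves a unit eigenvector to the first coordinate. The first
  column of the conjugated matrix \<open>B\<close> then vanishes below the eigenvalue and, by
  symmetry, so does the first row to its right; induction handles the remaining symmetric
  block.\<close>

lemma real_symmetric_diagonalizable:
  fixes A :: "real mat"
  assumes "A \<in> carrier_mat n n" and "transpose_mat A = A"
  shows "\<exists>P \<in> carrier_mat n n. transpose_mat P * P = 1\<^sub>m n \<and> diagonal_mat (transpose_mat P * A * P)"
  using assms
proof (induction n arbitrary: A)
  case 0
  then show ?case by (intro bexI[of _ "1\<^sub>m 0"]) (auto simp: diagonal_mat_def)
next
  case (Suc n)
  note A = Suc.prems(1) and sym = Suc.prems(2)
  obtain r u where u: "u \<in> carrier_vec (Suc n)" "u \<noteq> 0\<^sub>v (Suc n)" and Au: "A *\<^sub>v u = r \<cdot>\<^sub>v u"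
    using real_symmetric_eigenvalue[OF A sym] A unfolding eigenvalue_def eigenvector_def by auto
  have uu: "u \<bullet> u > 0" using conjugate_square_greater_0_vec[OF u(1)] u(2) by simp
  define v where "v = (1 / sqrt (u \<bullet> u)) \<cdot>\<^sub>v u"
  have v: "v \<in> carrier_vec (Suc n)" and vv: "v \<bullet> v = 1"
    using u uu by (auto simp: v_def)
  have Av: "A *\<^sub>v v = r \<cdot>\<^sub>v v"
    using u A by (simp add: v_def Au mult_mat_vec[OF A] smult_smult_assoc mult.commute)
  obtain H where H: "H \<in> carrier_mat (Suc n) (Suc n)" and Ht: "transpose_mat H = H"
    and HH: "H * H = 1\<^sub>m (Suc n)" and Hv: "col H 0 = v"
    using orthogonal_mat_first_col[OF v _ vv] by auto
  define B where "B = H * A * H"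
  have B: "B \<in> carrier_mat (Suc n) (Suc n)" using H A by (simp add: B_def)
  have Bt: "transpose_mat B = B"
    using H A by (simp add: B_def transpose_mult[of _ "Suc n" "Suc n" _ "Suc n"] Ht sym
        assoc_mult_mat[of _ "Suc n" "Suc n" _ "Suc n" _ "Suc n"])
  have "col B 0 = (H * A) *\<^sub>v v"
    unfolding B_def using H A Hv by (subst col_mult2[of _ "Suc n" "Suc n" _ "Suc n"]) auto
  also have "\<dots> = r \<cdot>\<^sub>v (H *\<^sub>v v)"
    using H A v by (simp add: assoc_mult_mat_vec[of _ "Suc n" "Suc n"] Av mult_mat_vec[OF H])
  also have "H *\<^sub>v v = col (H * H) 0"
    using H Hv by (subst col_mult2[of _ "Suc n" "Suc n" _ "Suc n"]) auto
  finally have colB: "col B 0 = r \<cdot>\<^sub>v unit_vec (Suc n) 0" by (simp add: HH)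
  have Bi0: "B $$ (i, 0) = (if i = 0 then r else 0)" if "i < Suc n" for i
    using arg_cong[OF colB, of "\<lambda>x. x $ i"] that B by simp
  have B0i: "B $$ (0, i) = (if i = 0 then r else 0)" if "i < Suc n" for i
    using Bi0[OF that] that B Bt by (metis carrier_matD index_transpose_mat(1) zero_less_Suc)
  define A' where "A' = mat n n (\<lambda>(i, j). B $$ (Suc i, Suc j))"
  have A': "A' \<in> carrier_mat n n" by (simp add: A'_def)
  have "transpose_mat A' = A'"
  proof (rule eq_matI)
    fix i j assume "i < dim_row A'" "j < dim_col A'"
    then show "transpose_mat A' $$ (i, j) = A' $$ (i, j)"
      using B Bt by (auto simp: A'_def) (metis Suc_mono carrier_matD index_transpose_mat(1))
  qed (auto simp: A'_def)
  from Suc.IH[OF A' this] obtain P where P: "P \<in> carrier_mat n n"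
    and PP: "transpose_mat P * P = 1\<^sub>m n" and dP: "diagonal_mat (transpose_mat P * A' * P)" by auto
  let ?Z = "0\<^sub>m 1 n :: real mat" and ?Z' = "0\<^sub>m n 1 :: real mat" and ?r = "mat 1 1 (\<lambda>_. r)"
  have Bb: "B = four_block_mat ?r ?Z ?Z' A'"
    by (rule eq_matI) (use B Bi0 B0i in \<open>auto simp: A'_def\<close>)
  define Q where "Q = four_block_mat (1\<^sub>m 1) ?Z ?Z' P"
  have Q: "Q \<in> carrier_mat (Suc n) (Suc n)" using P unfolding Q_def by auto
  have Qt: "transpose_mat Q = four_block_mat (1\<^sub>m 1) ?Z ?Z' (transpose_mat P)"
    unfolding Q_def by (subst transpose_four_block_mat[of _ 1 1 _ n _ n]) (use P in auto)
  have QQ: "transpose_mat Q * Q = 1\<^sub>m (Suc n)"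
    unfolding Qt unfolding Q_def
    by (subst mult_four_block_mat[of _ 1 1 _ n _ n _ _ 1 _ n]) (use P PP in auto)
  have QBQ: "transpose_mat Q * B * Q = four_block_mat ?r ?Z ?Z' (transpose_mat P * A' * P)"
  proof -
    have "transpose_mat Q * B = four_block_mat ?r ?Z ?Z' (transpose_mat P * A')"
      unfolding Qt Bb by (subst mult_four_block_mat[of _ 1 1 _ n _ n _ _ 1 _ n]) (use P A' in auto)
    then show ?thesis unfolding Q_def
      by (simp, subst mult_four_block_mat[of _ 1 1 _ n _ n _ _ 1 _ n]) (use P A' in auto)
  qed
  have "diagonal_mat (transpose_mat Q * B * Q)"
    unfolding QBQ using dP P A' by (auto simp: diagonal_mat_def)
  moreover have "transpose_mat (H * Q) * A * (H * Q) = transpose_mat Q * B * Q"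
    using H A Q by (simp add: B_def Ht transpose_mult[of _ "Suc n" "Suc n" _ "Suc n"] assoc_mult_mat[of _ "Suc n" "Suc n" _ "Suc n" _ "Suc n"])
  moreover have "transpose_mat (H * Q) * (H * Q) = transpose_mat Q * ((H * H) * Q)"
    using H Q by (simp add: Ht transpose_mult[of _ "Suc n" "Suc n" _ "Suc n"] assoc_mult_mat[of _ "Suc n" "Suc n" _ "Suc n" _ "Suc n"])
  ultimately show ?case using H Q QQ by (intro bexI[of _ "H * Q"]) (auto simp: HH)
qed

subsection \<open>The nuclear norm as a projective norm\<close>

lemma proots_prod_linear_factors:
  fixes xs :: "'a::idom list"
  shows "proots (\<Prod>a\<leftarrow>xs. [:- a, 1:]) = mset xs"
proof (induction xs)
  case (Cons x xs)
  have "(\<Prod>a\<leftarrow>xs. [:- a, 1:]) \<noteq> 0" by (auto simp: prod_list_zero_iff)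
  then show ?case using Cons.IH by (simp add: proots_mult del: mult_pCons_left)
qed simp

text \<open>Right singular vectors \<open>p k\<close> and their images \<open>w k\<close>; the lengths of the images are the
  singular values.\<close>

lemma singular_vectors:
  fixes A :: "real mat"
  assumes A: "A \<in> carrier_mat m n"
  obtains w p :: "nat \<Rightarrow> nat \<Rightarrow> real" where
    "\<And>i j. i < m \<Longrightarrow> j < n \<Longrightarrow> A $$ (i, j) = (\<Sum>k<n. w k i * p k j)"
    "\<And>i k. i < m \<Longrightarrow> k < n \<Longrightarrow> w k i = (\<Sum>j<n. A $$ (i, j) * p k j)"
    "\<And>k l. k < n \<Longrightarrow> l < n \<Longrightarrow> (\<Sum>j<n. p k j * p l j) = (if k = l then 1 else 0)"
    "\<And>k l. k < n \<Longrightarrow> l < n \<Longrightarrow> k \<noteq> l \<Longrightarrow> (\<Sum>i<m. w k i * w l i) = 0"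
    "schatten1_norm A = (\<Sum>k<n. L2_set (w k) {..<m})"
proof -
  let ?G = "transpose_mat A * A"
  have G: "?G \<in> carrier_mat n n" using A by simp
  have "transpose_mat ?G = ?G" using A by (simp add: transpose_mult[of _ n m _ n])
  from real_symmetric_diagonalizable[OF G this] obtain P where P: "P \<in> carrier_mat n n"
    and PP: "transpose_mat P * P = 1\<^sub>m n" and diag: "diagonal_mat (transpose_mat P * ?G * P)"
    by auto
  have PP': "P * transpose_mat P = 1\<^sub>m n"
    by (rule mat_mult_left_right_inverse[OF _ P PP]) (use P in simp)
  define W where "W = A * P"
  have W: "W \<in> carrier_mat m n" using A P by (simp add: W_def)
  \<comment> \<open>\<open>D\<close> is the Gram matrix of the columns of \<open>A * P\<close>. That
    it is diagonal means that these columns are orthogonal, with squared lengths on the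
    diagonal.\<close>
  define D where "D = transpose_mat W * W"
  have D: "D \<in> carrier_mat n n" using W by (simp add: D_def)
  have Deq: "D = transpose_mat P * ?G * P"
  proof -
    have "D = transpose_mat P * transpose_mat A * (A * P)"
      unfolding D_def W_def by (subst transpose_mult[OF A P]) simp
    also have "\<dots> = transpose_mat P * (transpose_mat A * (A * P))"
      using A P by (intro assoc_mult_mat[of _ n n _ m _ n]) auto
    also have "transpose_mat A * (A * P) = ?G * P"
      using A P by (intro assoc_mult_mat[symmetric, of _ n m _ n _ n]) auto
    also have "transpose_mat P * (?G * P) = transpose_mat P * ?G * P"
      using A P by (intro assoc_mult_mat[symmetric, of _ n n _ n _ n]) auto
    finally show ?thesis .
  qed
  have dD: "D $$ (k, l) = (\<Sum>i<m. W $$ (i, k) * W $$ (i, l))" if "k < n" "l < n" for k l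
    using that W by (simp add: D_def scalar_prod_def lessThan_atLeast0)
  have D0: "D $$ (k, l) = 0" if "k < n" "l < n" "k \<noteq> l" for k l
    using diag D that unfolding Deq[symmetric] diagonal_mat_def by auto
  have "?G = P * D * transpose_mat P"
  proof -
    have "P * D * transpose_mat P = (P * transpose_mat P) * ?G * (P * transpose_mat P)"
      unfolding Deq using P G by (simp add: assoc_mult_mat[of _ n n _ n _ n])
    then show ?thesis using A by (simp add: PP')
  qed
  \<comment> \<open>Similar matrices share the characteristic polynomial, so the diagonal of
    \<open>D\<close> lists the eigenvalues of \<open>?G\<close> with multiplicity.\<close>
  then have "similar_mat ?G D"
    using P G D PP PP' by (intro similar_matI[of _ _ P "transpose_mat P" n]) auto
  then have "char_poly ?G = char_poly D" by (rule char_poly_similar)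
  also have "\<dots> = (\<Prod>a\<leftarrow>diag_mat D. [:- a, 1:])"
    using D D0 by (intro char_poly_upper_triangular[of _ n]) (auto simp: upper_triangular_def)
  finally have "proots (char_poly ?G) = mset (diag_mat D)"
    by (simp add: proots_prod_linear_factors)
  then have "schatten1_norm A = sum_list (map sqrt (diag_mat D))"
    by (simp add: schatten1_norm_def singular_values_def flip: sum_mset_sum_list)
  also have "\<dots> = (\<Sum>k<n. sqrt (D $$ (k, k)))"
    using D by (simp add: diag_mat_def sum_list_distinct_conv_sum_set lessThan_atLeast0 o_def)
  also have "\<dots> = (\<Sum>k<n. L2_set (\<lambda>i. W $$ (i, k)) {..<m})"
    by (simp add: dD L2_set_def power2_eq_square)
  finally have S: "schatten1_norm A = (\<Sum>k<n. L2_set (\<lambda>i. W $$ (i, k)) {..<m})" .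
  have AW: "A = W * transpose_mat P"
    using A P by (simp add: W_def assoc_mult_mat[of _ m n _ n _ n] PP')
  show thesis
  proof (rule that[of "\<lambda>k i. W $$ (i, k)" "\<lambda>k j. P $$ (j, k)"])
    show "A $$ (i, j) = (\<Sum>k<n. W $$ (i, k) * P $$ (j, k))" if "i < m" "j < n" for i j
      using that W P by (subst AW) (simp add: scalar_prod_def lessThan_atLeast0)
    show "W $$ (i, k) = (\<Sum>j<n. A $$ (i, j) * P $$ (j, k))" if "i < m" "k < n" for i k
      using that A P by (simp add: W_def scalar_prod_def lessThan_atLeast0)
    show "(\<Sum>j<n. P $$ (j, k) * P $$ (j, l)) = (if k = l then 1 else 0)" if "k < n" "l < n" for k l
    proof -
      have "(transpose_mat P * P) $$ (k, l) = (if k = l then 1 else 0)" using that by (simp add: PP)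
      then show ?thesis using that P by (simp add: scalar_prod_def lessThan_atLeast0)
    qed
    show "(\<Sum>i<m. W $$ (i, k) * W $$ (i, l)) = 0" if "k < n" "l < n" "k \<noteq> l" for k l
      using dD[of k l] D0[of k l] that by simp
  qed (rule S)
qed

section \<open>Cauchy-Schwarz and Bessel inequalities\<close>

lemma Cauchy_Schwarz_sum:
  fixes f g :: "'a \<Rightarrow> real"
  shows "(\<Sum>i\<in>A. f i * g i) \<le> L2_set f A * L2_set g A"
  by (rule order_trans[OF _ L2_set_mult_ineq]) (intro sum_mono, metis abs_ge_self abs_mult)

lemma L2_set_square: "(L2_set f A)\<^sup>2 = (\<Sum>i\<in>A. (f i)\<^sup>2)"
  by (simp add: L2_set_def sum_nonneg)

text \<open>With \<open>?g\<close> the combination of the \<open>e k\<close> with coefficients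
  \<open>c k\<close>, expand the squared length of \<open>u - ?g\<close>, which is nonnegative.
  Lengths at most 1 instead of exactly 1 admit zero vectors, which occur as left singular vectors
  for the singular value 0.\<close>

lemma Bessel_inequality:
  fixes e :: "'k \<Rightarrow> 'a \<Rightarrow> real"
  assumes fin: "finite K"
    and orth: "\<And>k l. k \<in> K \<Longrightarrow> l \<in> K \<Longrightarrow> k \<noteq> l \<Longrightarrow> (\<Sum>i\<in>A. e k i * e l i) = 0"
    and norm: "\<And>k. k \<in> K \<Longrightarrow> (\<Sum>i\<in>A. e k i * e k i) \<le> 1"
  shows "L2_set (\<lambda>k. \<Sum>i\<in>A. e k i * u i) K \<le> L2_set u A"
proof -
  define c where "c k = (\<Sum>i\<in>A. e k i * u i)" for k
  let ?g = "\<lambda>i. \<Sum>k\<in>K. c k * e k i"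
  have "(\<Sum>i\<in>A. ?g i * ?g i) = (\<Sum>i\<in>A. \<Sum>k\<in>K. \<Sum>l\<in>K. c k * c l * (e k i * e l i))"
    by (simp add: sum_product mult_ac)
  also have "\<dots> = (\<Sum>k\<in>K. \<Sum>l\<in>K. c k * c l * (\<Sum>i\<in>A. e k i * e l i))"
    by (subst sum.swap, intro sum.cong refl, subst sum.swap) (simp add: sum_distrib_left)
  also have "\<dots> = (\<Sum>k\<in>K. \<Sum>l\<in>K. if l = k then c k * c k * (\<Sum>i\<in>A. e k i * e k i) else 0)"
    by (intro sum.cong refl) (auto simp: orth)
  also have "\<dots> = (\<Sum>k\<in>K. c k * c k * (\<Sum>i\<in>A. e k i * e k i))"
    using fin by simp
  also have "\<dots> \<le> (\<Sum>k\<in>K. c k * c k)"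
    by (intro sum_mono mult_left_le norm) auto
  finally have gg: "(\<Sum>i\<in>A. ?g i * ?g i) \<le> (\<Sum>k\<in>K. c k * c k)" .
  have gu: "(\<Sum>i\<in>A. ?g i * u i) = (\<Sum>k\<in>K. c k * c k)"
    unfolding sum_distrib_right
    by (subst sum.swap) (simp add: c_def mult.assoc flip: sum_distrib_left)
  have "0 \<le> (\<Sum>i\<in>A. (u i - ?g i) * (u i - ?g i))" by (simp add: sum_nonneg)
  also have "\<dots> = (\<Sum>i\<in>A. u i * u i) - 2 * (\<Sum>i\<in>A. ?g i * u i) + (\<Sum>i\<in>A. ?g i * ?g i)"
  proof -
    have "(u i - ?g i) * (u i - ?g i) = u i * u i - 2 * (?g i * u i) + ?g i * ?g i" for i
      by (simp add: left_diff_distrib right_diff_distrib mult.commute)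
    then show ?thesis by (simp only: sum.distrib sum_subtractf sum_distrib_left[of 2])
  qed
  finally have "(\<Sum>k\<in>K. c k * c k) \<le> (\<Sum>i\<in>A. u i * u i)" using gg gu by simp
  then show ?thesis by (simp add: L2_set_def c_def power2_eq_square)
qed

section \<open>Bounds by rank-one decompositions\<close>

text \<open>A relation to an upper bound avoids an infimum over decompositions. Arbitrary index sets
  let lists, pairs and functions on positions serve as row and column indices without being
  enumerated.\<close>

definition nuclear_bound :: "'a set \<Rightarrow> 'b set \<Rightarrow> ('a \<Rightarrow> 'b \<Rightarrow> real) \<Rightarrow> real \<Rightarrow> bool" where
  "nuclear_bound A B F c \<longleftrightarrow> (\<exists>(N::nat) u v.
     (\<forall>x\<in>A. \<forall>y\<in>B. F x y = (\<Sum>i<N. u i x * v i y)) \<and>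
     (\<Sum>i<N. L2_set (u i) A * L2_set (v i) B) \<le> c)"

lemma nuclear_boundI:
  assumes fin: "finite K"
    and F: "\<And>x y. x \<in> A \<Longrightarrow> y \<in> B \<Longrightarrow> F x y = (\<Sum>i\<in>K. u i x * v i y)"
    and c: "(\<Sum>i\<in>K. L2_set (u i) A * L2_set (v i) B) \<le> c"
  shows "nuclear_bound A B F c"
proof -
  obtain h where h: "bij_betw h {..<card K} K"
    using ex_bij_betw_nat_finite[OF fin] by (auto simp: lessThan_atLeast0)
  show ?thesis unfolding nuclear_bound_def
    using F c
    by (intro exI[of _ "card K"] exI[of _ "\<lambda>i. u (h i)"] exI[of _ "\<lambda>i. v (h i)"])
      (simp add: sum.reindex_bij_betw[OF h, of "\<lambda>i. u i _ * v i _"]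
        sum.reindex_bij_betw[OF h, of "\<lambda>i. L2_set (u i) A * L2_set (v i) B"])
qed

lemma nuclear_boundE:
  assumes "nuclear_bound A B F c"
  obtains N :: nat and u v where
    "\<And>x y. x \<in> A \<Longrightarrow> y \<in> B \<Longrightarrow> F x y = (\<Sum>i<N. u i x * v i y)"
    "(\<Sum>i<N. L2_set (u i) A * L2_set (v i) B) \<le> c"
  using assms unfolding nuclear_bound_def by blast

text \<open>Left to right, the singular value decomposition is itself a decomposition of weight
  \<open>schatten1_norm ?A\<close>, as the \<open>p k\<close> are unit vectors. Right to left is
  trace duality: the norm is the sum over \<open>k\<close> of the bilinear form of \<open>?A\<close>
  at the left and right singular vectors \<open>e k\<close> and \<open>p k\<close>, and a rank-one
  term contributes at most the product of its two lengths.\<close>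

lemma schatten1_norm_le_iff:
  "schatten1_norm (mat m n (\<lambda>(i, j). F i j)) \<le> c \<longleftrightarrow> nuclear_bound {..<m} {..<n} F c"
proof -
  let ?A = "mat m n (\<lambda>(i, j). F i j)"
  obtain w p where A: "\<And>i j. i < m \<Longrightarrow> j < n \<Longrightarrow> ?A $$ (i, j) = (\<Sum>k<n. w k i * p k j)"
    and w: "\<And>i k. i < m \<Longrightarrow> k < n \<Longrightarrow> w k i = (\<Sum>j<n. ?A $$ (i, j) * p k j)"
    and p: "\<And>k l. k < n \<Longrightarrow> l < n \<Longrightarrow> (\<Sum>j<n. p k j * p l j) = (if k = l then 1 else 0)"
    and ww: "\<And>k l. k < n \<Longrightarrow> l < n \<Longrightarrow> k \<noteq> l \<Longrightarrow> (\<Sum>i<m. w k i * w l i) = 0"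
    and S: "schatten1_norm ?A = (\<Sum>k<n. L2_set (w k) {..<m})"
    by (rule singular_vectors[OF mat_carrier[of m n "\<lambda>(i, j). F i j"]], rule that)
  show ?thesis
  proof
    assume c: "schatten1_norm ?A \<le> c"
    have "L2_set (p k) {..<n} = 1" if "k < n" for k
      using p[OF that that] by (simp add: L2_set_def power2_eq_square)
    then show "nuclear_bound {..<m} {..<n} F c"
      using c A unfolding S by (intro nuclear_boundI[of "{..<n}" _ _ _ w p]) auto
  next
    assume "nuclear_bound {..<m} {..<n} F c"
    then obtain N u v
      where F: "\<And>x y. x \<in> {..<m} \<Longrightarrow> y \<in> {..<n} \<Longrightarrow> F x y = (\<Sum>r<N::nat. u r x * v r y)"
        and c: "(\<Sum>r<N. L2_set (u r) {..<m} * L2_set (v r) {..<n}) \<le> c"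
      by (rule nuclear_boundE) blast
    \<comment> \<open>Left singular vectors; \<open>e k = 0\<close> if the singular value is 0, as then the denominator is 0.\<close>
    define e where "e k i = w k i / L2_set (w k) {..<m}" for k i
    have wsq: "(\<Sum>i<m. w k i * w k i) = L2_set (w k) {..<m} * L2_set (w k) {..<m}" for k
      using L2_set_square[of "w k" "{..<m}"] by (simp add: power2_eq_square)
    have e: "L2_set (w k) {..<m} = (\<Sum>i<m. e k i * w k i)" for k
    proof -
      have "(\<Sum>i<m. e k i * w k i) = (\<Sum>i<m. w k i * w k i) / L2_set (w k) {..<m}"
        by (simp add: e_def sum_divide_distrib)
      then show ?thesis by (simp add: wsq)
    qed
    have ee: "(\<Sum>i<m. e k i * e l i) = (\<Sum>i<m. w k i * w l i) / (L2_set (w k) {..<m} * L2_set (w l) {..<m})"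
      for k l by (simp add: e_def sum_divide_distrib)
    have "(\<Sum>i<m. e k i * e k i) \<le> 1" for k
      unfolding ee wsq by simp
    then have Be: "L2_set (\<lambda>k. \<Sum>i<m. e k i * u r i) {..<n} \<le> L2_set (u r) {..<m}" for r
      by (intro Bessel_inequality) (auto simp: ee ww)
    have Bp: "L2_set (\<lambda>k. \<Sum>j<n. p k j * v r j) {..<n} \<le> L2_set (v r) {..<n}" for r
      by (intro Bessel_inequality) (auto simp: p)
    have wk: "w k i = (\<Sum>r<N. u r i * (\<Sum>j<n. p k j * v r j))" if "k < n" "i < m" for k i
    proof -
      have "w k i = (\<Sum>j<n. \<Sum>r<N. u r i * (p k j * v r j))"
        unfolding w[OF that(2,1)] using that
        by (intro sum.cong refl) (simp add: F sum_distrib_left sum_distrib_right mult_ac)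
      also have "\<dots> = (\<Sum>r<N. \<Sum>j<n. u r i * (p k j * v r j))" by (rule sum.swap)
      finally show ?thesis by (simp add: sum_distrib_left)
    qed
    \<comment> \<open>The sum over \<open>r\<close> is moved outside so that each rank-one term is
      estimated alone: Cauchy-Schwarz over \<open>k\<close>, then Bessel for both orthogonal
      systems.\<close>
    have "schatten1_norm ?A = (\<Sum>k<n. \<Sum>i<m. e k i * w k i)" unfolding S e ..
    also have "\<dots> = (\<Sum>k<n. \<Sum>i<m. \<Sum>r<N. e k i * u r i * (\<Sum>j<n. p k j * v r j))"
      by (intro sum.cong refl) (simp add: wk sum_distrib_left mult_ac)
    also have "\<dots> = (\<Sum>k<n. \<Sum>r<N. \<Sum>i<m. e k i * u r i * (\<Sum>j<n. p k j * v r j))"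
      by (intro sum.cong refl sum.swap)
    also have "\<dots> = (\<Sum>r<N. \<Sum>k<n. \<Sum>i<m. e k i * u r i * (\<Sum>j<n. p k j * v r j))"
      by (rule sum.swap)
    also have "\<dots> = (\<Sum>r<N. \<Sum>k<n. (\<Sum>i<m. e k i * u r i) * (\<Sum>j<n. p k j * v r j))"
      by (simp add: sum_distrib_right)
    also have "\<dots> \<le> (\<Sum>r<N. L2_set (\<lambda>k. \<Sum>i<m. e k i * u r i) {..<n} * L2_set (\<lambda>k. \<Sum>j<n. p k j * v r j) {..<n})"
      by (intro sum_mono Cauchy_Schwarz_sum)
    also have "\<dots> \<le> (\<Sum>r<N. L2_set (u r) {..<m} * L2_set (v r) {..<n})"
      by (intro sum_mono mult_mono Be Bp) auto
    finally show "schatten1_norm ?A \<le> c" using c by simp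
  qed
qed

lemma nuclear_bound_cong:
  assumes "nuclear_bound A B F c" and "\<And>x y. x \<in> A \<Longrightarrow> y \<in> B \<Longrightarrow> F x y = G x y"
  shows "nuclear_bound A B G c"
  using assms unfolding nuclear_bound_def by simp

lemma nuclear_bound_transpose:
  assumes "nuclear_bound A B F c"
  shows "nuclear_bound B A (\<lambda>y x. F x y) c"
proof -
  obtain N u v where "\<And>x y. x \<in> A \<Longrightarrow> y \<in> B \<Longrightarrow> F x y = (\<Sum>i<N::nat. u i x * v i y)"
    "(\<Sum>i<N. L2_set (u i) A * L2_set (v i) B) \<le> c"
    using assms by (rule nuclear_boundE) blast
  then show ?thesis by (intro nuclear_boundI[of "{..<N}" _ _ _ v u]) (simp_all add: mult.commute)
qed

lemma nuclear_bound_scale: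
  assumes "nuclear_bound A B F c" and a: "0 \<le> a"
  shows "nuclear_bound A B (\<lambda>x y. a * F x y) (a * c)"
proof -
  obtain N u v where F: "\<And>x y. x \<in> A \<Longrightarrow> y \<in> B \<Longrightarrow> F x y = (\<Sum>i<N::nat. u i x * v i y)"
    and c: "(\<Sum>i<N. L2_set (u i) A * L2_set (v i) B) \<le> c"
    using assms(1) by (rule nuclear_boundE) blast
  show ?thesis
    using mult_left_mono[OF c a] F
    by (intro nuclear_boundI[of "{..<N}" _ _ _ "\<lambda>i x. a * u i x" v])
      (simp_all add: sum_distrib_left mult.assoc flip: L2_set_right_distrib[OF a])
qed

text \<open>Decompositions of the summands are joined into one, indexed by a disjoint union.\<close>

lemma nuclear_bound_sum:
  assumes fin: "finite S" and nb: "\<And>s. s \<in> S \<Longrightarrow> nuclear_bound A B (F s) (c s)"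
  shows "nuclear_bound A B (\<lambda>x y. \<Sum>s\<in>S. F s x y) (\<Sum>s\<in>S. c s)"
proof -
  from nb have "\<forall>s\<in>S. \<exists>(N::nat) u v. (\<forall>x\<in>A. \<forall>y\<in>B. F s x y = (\<Sum>i<N. u i x * v i y)) \<and>
      (\<Sum>i<N. L2_set (u i) A * L2_set (v i) B) \<le> c s"
    unfolding nuclear_bound_def by blast
  then obtain N u v where
    F: "\<And>s x y. s \<in> S \<Longrightarrow> x \<in> A \<Longrightarrow> y \<in> B \<Longrightarrow> F s x y = (\<Sum>i<N s::nat. u s i x * v s i y)"
    and c: "\<And>s. s \<in> S \<Longrightarrow> (\<Sum>i<N s. L2_set (u s i) A * L2_set (v s i) B) \<le> c s"
    unfolding bchoice_iff by blast
  have sum: "(\<Sum>s\<in>S. \<Sum>i<N s. f s i) = (\<Sum>k\<in>Sigma S (\<lambda>s. {..<N s}). f (fst k) (snd k))"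
    for f :: "_ \<Rightarrow> nat \<Rightarrow> real"
    using fin by (subst sum.Sigma) (auto simp: case_prod_unfold)
  have "(\<Sum>s\<in>S. \<Sum>i<N s. L2_set (u s i) A * L2_set (v s i) B) \<le> (\<Sum>s\<in>S. c s)"
    by (intro sum_mono c)
  then show ?thesis
    using fin by (intro nuclear_boundI[of "Sigma S (\<lambda>s. {..<N s})" _ _ _
          "\<lambda>k. u (fst k) (snd k)" "\<lambda>k. v (fst k) (snd k)"]) (simp_all add: F sum)
qed

text \<open>Tensor products of rank-one terms have rank one, and Euclidean lengths multiply under
  tensor products.\<close>

lemma nuclear_bound_times:
  assumes "nuclear_bound A B F c" and "nuclear_bound A' B' G d"
  shows "nuclear_bound (A \<times> A') (B \<times> B') (\<lambda>x y. F (fst x) (fst y) * G (snd x) (snd y)) (c * d)"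
proof -
  obtain N u v where F: "\<And>x y. x \<in> A \<Longrightarrow> y \<in> B \<Longrightarrow> F x y = (\<Sum>i<N::nat. u i x * v i y)"
    and c: "(\<Sum>i<N. L2_set (u i) A * L2_set (v i) B) \<le> c"
    using assms(1) by (rule nuclear_boundE) blast
  obtain N' u' v' where G: "\<And>x y. x \<in> A' \<Longrightarrow> y \<in> B' \<Longrightarrow> G x y = (\<Sum>i<N'::nat. u' i x * v' i y)"
    and d: "(\<Sum>i<N'. L2_set (u' i) A' * L2_set (v' i) B') \<le> d"
    using assms(2) by (rule nuclear_boundE) blast
  have L2: "L2_set (\<lambda>x. f (fst x) * g (snd x)) (X \<times> Y) = L2_set f X * L2_set g Y"
    for f :: "'x \<Rightarrow> real" and g :: "'y \<Rightarrow> real" and X Y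
    by (simp add: L2_set_def power_mult_distrib sum_product sum.cartesian_product
        case_prod_unfold flip: real_sqrt_mult)
  \<comment> \<open>The bound dominates a sum of products of lengths; its sign is what allows the
    two estimates to be multiplied.\<close>
  have "0 \<le> c" by (rule order_trans[OF _ c]) (simp add: sum_nonneg)
  have prod: "(\<Sum>i<N. f i) * (\<Sum>j<N'. g j) = (\<Sum>k\<in>{..<N} \<times> {..<N'}. f (fst k) * g (snd k))"
    for f g :: "nat \<Rightarrow> real"
    by (simp only: sum_product sum.cartesian_product case_prod_unfold)
  have "(\<Sum>k\<in>{..<N} \<times> {..<N'}. L2_set (\<lambda>x. u (fst k) (fst x) * u' (snd k) (snd x)) (A \<times> A') *
      L2_set (\<lambda>y. v (fst k) (fst y) * v' (snd k) (snd y)) (B \<times> B'))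
      = (\<Sum>i<N. L2_set (u i) A * L2_set (v i) B) * (\<Sum>i<N'. L2_set (u' i) A' * L2_set (v' i) B')"
    unfolding L2 prod by (intro sum.cong refl) (simp only: mult_ac)
  also have "\<dots> \<le> c * d"
    using \<open>0 \<le> c\<close> by (intro mult_mono c d) (auto simp: sum_nonneg)
  finally show ?thesis
    by (intro nuclear_boundI[of "{..<N} \<times> {..<N'}" _ _ _ "\<lambda>k x. u (fst k) (fst x) * u' (snd k) (snd x)"
          "\<lambda>k y. v (fst k) (fst y) * v' (snd k) (snd y)"])
      (auto simp: F G prod intro!: sum.cong)
qed

lemma L2_set_reindex_bij_betw:
  "bij_betw h A' A \<Longrightarrow> L2_set (\<lambda>x. f (h x)) A' = L2_set f A"
  unfolding L2_set_def by (subst sum.reindex_bij_betw[of h A' A "\<lambda>x. (f x)\<^sup>2", symmetric]) auto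

lemma nuclear_bound_reindex:
  assumes f: "bij_betw f A' A" and g: "bij_betw g B' B"
  shows "nuclear_bound A' B' (\<lambda>x y. F (f x) (g y)) c \<longleftrightarrow> nuclear_bound A B F c"
proof -
  \<comment> \<open>Stated for arbitrary types and sets, so that the converse follows by inserting
    the inverse bijections.\<close>
  have *: "nuclear_bound A' B' (\<lambda>x y. F (f x) (g y)) c"
    if nb: "nuclear_bound A B F c" and f: "bij_betw f A' A" and g: "bij_betw g B' B"
    for A :: "'x set" and A' :: "'y set" and f and B :: "'w set" and B' :: "'z set" and g F
  proof -
    obtain N u v where F: "\<And>x y. x \<in> A \<Longrightarrow> y \<in> B \<Longrightarrow> F x y = (\<Sum>i<N::nat. u i x * v i y)"
      and c: "(\<Sum>i<N. L2_set (u i) A * L2_set (v i) B) \<le> c"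
      using nb by (rule nuclear_boundE) blast
    show ?thesis
      using F c bij_betw_apply[OF f] bij_betw_apply[OF g]
      by (intro nuclear_boundI[of "{..<N}" _ _ _ "\<lambda>i x. u i (f x)" "\<lambda>i y. v i (g y)"])
        (auto simp: L2_set_reindex_bij_betw[OF f] L2_set_reindex_bij_betw[OF g])
  qed
  show ?thesis
  proof
    assume "nuclear_bound A' B' (\<lambda>x y. F (f x) (g y)) c"
    from *[OF this bij_betw_inv_into[OF f] bij_betw_inv_into[OF g]]
    show "nuclear_bound A B F c"
      by (rule nuclear_bound_cong) (simp add: bij_betw_inv_into_right[OF f] bij_betw_inv_into_right[OF g])
  qed (rule *[OF _ f g])
qed

lemma L2_set_sum_le:
  "L2_set (\<lambda>x. \<Sum>i\<in>K. f i x) A \<le> (\<Sum>i\<in>K. L2_set (f i) A)"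
proof (induction K rule: infinite_finite_induct)
  case (insert k K)
  then show ?case
    using L2_set_triangle_ineq[of "f k" "\<lambda>x. \<Sum>i\<in>K. f i x" A] by simp
qed (simp_all add: L2_set_def)

text \<open>The left side is the Frobenius norm. It equals the product of the two lengths on a
  rank-one term, so the triangle inequality suffices.\<close>

lemma L2_set_le_nuclear_bound:
  assumes "nuclear_bound A B F c"
  shows "L2_set (\<lambda>(x, y). F x y) (A \<times> B) \<le> c"
proof -
  obtain N u v where F: "\<And>x y. x \<in> A \<Longrightarrow> y \<in> B \<Longrightarrow> F x y = (\<Sum>i<N::nat. u i x * v i y)"
    and c: "(\<Sum>i<N. L2_set (u i) A * L2_set (v i) B) \<le> c"
    using assms by (rule nuclear_boundE) blast
  have "L2_set (\<lambda>(x, y). F x y) (A \<times> B) = L2_set (\<lambda>x. \<Sum>i<N. u i (fst x) * v i (snd x)) (A \<times> B)"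
    by (rule L2_set_cong) (auto simp: F)
  also have "\<dots> \<le> (\<Sum>i<N. L2_set (\<lambda>x. u i (fst x) * v i (snd x)) (A \<times> B))"
    by (rule L2_set_sum_le)
  also have "\<dots> = (\<Sum>i<N. L2_set (u i) A * L2_set (v i) B)"
    by (simp add: L2_set_def power_mult_distrib sum_product sum.cartesian_product
        case_prod_unfold flip: real_sqrt_mult)
  finally show ?thesis using c by simp
qed

section \<open>Kronecker products over disjoint sets of positions\<close>

lemma bij_betw_PiE_Un:
  assumes "A \<inter> B = {}"
  shows "bij_betw (\<lambda>f. (restrict f A, restrict f B)) (PiE (A \<union> B) X) (PiE A X \<times> PiE B X)"
proof (rule bij_betw_byWitness[where f' = "\<lambda>p. \<lambda>a\<in>A \<union> B. if a \<in> A then fst p a else snd p a"])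
  let ?h = "\<lambda>p. \<lambda>a\<in>A \<union> B. if a \<in> A then fst p a else snd p a"
  show "\<forall>f\<in>PiE (A \<union> B) X. ?h (restrict f A, restrict f B) = f"
    by (auto simp: fun_eq_iff PiE_def extensional_def)
  show "\<forall>p\<in>PiE A X \<times> PiE B X. (restrict (?h p) A, restrict (?h p) B) = p"
    using assms by (auto simp: fun_eq_iff PiE_def extensional_def)
  show "(\<lambda>f. (restrict f A, restrict f B)) ` PiE (A \<union> B) X \<subseteq> PiE A X \<times> PiE B X"
    by auto
  show "?h ` (PiE A X \<times> PiE B X) \<subseteq> PiE (A \<union> B) X"
    by auto
qed

text \<open>A Kronecker product whose factors occupy scattered positions. With multi-indices as
  functions on positions, each factor just sees a restriction, and no order of positions has to be
  restored.\<close>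

lemma nuclear_bound_prod_PiE:
  assumes "finite S" and "disjoint_family_on P S" and "disjoint_family_on Q S"
    and "\<And>b. b \<in> S \<Longrightarrow> nuclear_bound (PiE (P b) X) (PiE (Q b) X) (F b) 1"
  shows "nuclear_bound (PiE (\<Union>b\<in>S. P b) X) (PiE (\<Union>b\<in>S. Q b) X)
    (\<lambda>f g. \<Prod>b\<in>S. F b (restrict f (P b)) (restrict g (Q b))) 1"
  using assms
proof (induction S rule: finite_induct)
  case empty
  show ?case
    \<comment> \<open>Over an empty set of positions there is exactly one function, so the empty
      product is a 1 by 1 matrix with entry 1.\<close>
    by (rule nuclear_boundI[of "{()}" _ _ _ "\<lambda>_ _. 1" "\<lambda>_ _. 1"]) (auto simp: L2_set_def)
next
  case (insert b S)
  let ?P = "\<Union>c\<in>S. P c" and ?Q = "\<Union>c\<in>S. Q c"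
  have disj: "P b \<inter> ?P = {}" "Q b \<inter> ?Q = {}"
    using insert.prems(1,2) insert.hyps(2) by (auto simp: disjoint_family_on_def)
  have "nuclear_bound (PiE ?P X) (PiE ?Q X)
      (\<lambda>f g. \<Prod>c\<in>S. F c (restrict f (P c)) (restrict g (Q c))) 1"
    by (rule insert.IH) (use insert.prems in \<open>auto simp: disjoint_family_on_def\<close>)
  from nuclear_bound_times[OF insert.prems(3)[OF insertI1] this]
  have "nuclear_bound (PiE (P b) X \<times> PiE ?P X) (PiE (Q b) X \<times> PiE ?Q X)
      (\<lambda>f g. F b (fst f) (fst g) * (\<Prod>c\<in>S. F c (restrict (snd f) (P c)) (restrict (snd g) (Q c)))) (1 * 1)" .
  from iffD2[OF nuclear_bound_reindex[OF bij_betw_PiE_Un[OF disj(1)] bij_betw_PiE_Un[OF disj(2)]] this]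
  have "nuclear_bound (PiE (P b \<union> ?P) X) (PiE (Q b \<union> ?Q) X)
      (\<lambda>f g. F b (restrict f (P b)) (restrict g (Q b)) *
        (\<Prod>c\<in>S. F c (restrict (restrict f ?P) (P c)) (restrict (restrict g ?Q) (Q c)))) (1 * 1)"
    by (simp only: fst_conv snd_conv)
  then have "nuclear_bound (PiE (P b \<union> ?P) X) (PiE (Q b \<union> ?Q) X)
      (\<lambda>f g. \<Prod>c\<in>insert b S. F c (restrict f (P c)) (restrict g (Q c))) (1 * 1)"
  proof (rule nuclear_bound_cong)
    have "restrict (restrict f ?P) (P c) = restrict f (P c)"
      "restrict (restrict f ?Q) (Q c) = restrict f (Q c)" if "c \<in> S" for c and f :: "'b \<Rightarrow> 'c"
      using that by (auto simp: fun_eq_iff restrict_def)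
    then show "F b (restrict f (P b)) (restrict g (Q b)) *
        (\<Prod>c\<in>S. F c (restrict (restrict f ?P) (P c)) (restrict (restrict g ?Q) (Q c)))
        = (\<Prod>c\<in>insert b S. F c (restrict f (P c)) (restrict g (Q c)))" for f g
      using insert.hyps by simp
  qed
  then show ?case by (simp only: UN_insert mult_1)
qed

subsection \<open>Symmetrized Kronecker powers\<close>

lemma bij_betw_nth_n_lists: "bij_betw ((!) (List.n_lists x [0..<n])) {..<n ^ x} (tuples n x)"
  by (rule bij_betw_nth) (auto simp: distinct_n_lists length_n_lists set_n_lists tuples_def)

lemma schatten1_norm_to_mat_le_iff:
  "schatten1_norm (to_mat n x y F) \<le> c \<longleftrightarrow> nuclear_bound (tuples n x) (tuples n y) F c"
  unfolding to_mat_def schatten1_norm_le_iff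
  by (rule nuclear_bound_reindex[OF bij_betw_nth_n_lists bij_betw_nth_n_lists])

lemma card_tuples: "card (tuples n x) = n ^ x"
  using bij_betw_same_card[OF bij_betw_nth_n_lists[of x n]] by simp

lemma finite_tuples: "finite (tuples n x)"
  using bij_betw_finite[OF bij_betw_nth_n_lists[of x n]] by simp

text \<open>Translates between the two encodings of multi-indices for positions listed in any order
  \<open>r\<close>. Surjectivity follows by counting.\<close>

lemma bij_betw_map_PiE:
  assumes "distinct r"
  shows "bij_betw (\<lambda>f. map f r) (PiE (set r) (\<lambda>_. {..<n})) (tuples n (length r))"
proof -
  have inj: "inj_on (\<lambda>f. map f r) (PiE (set r) (\<lambda>_. {..<n}))"
    by (rule inj_onI, rule PiE_ext) (auto simp: PiE_iff)
  have "(\<lambda>f. map f r) ` PiE (set r) (\<lambda>_. {..<n}) = tuples n (length r)"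
  proof (rule card_subset_eq[OF finite_tuples])
    show "(\<lambda>f. map f r) ` PiE (set r) (\<lambda>_. {..<n}) \<subseteq> tuples n (length r)"
      by (auto simp: tuples_def PiE_iff)
    show "card ((\<lambda>f. map f r) ` PiE (set r) (\<lambda>_. {..<n})) = card (tuples n (length r))"
      using assms by (simp add: card_image[OF inj] card_PiE card_tuples distinct_card)
  qed
  with inj show ?thesis by (simp add: bij_betw_def)
qed

lemma bij_betw_append_tuples:
  "bij_betw (\<lambda>(I, J). I @ J) (tuples n x \<times> tuples n y) (tuples n (x + y))"
  by (rule bij_betw_byWitness[of _ "\<lambda>K. (take x K, drop x K)"])
    (auto simp: tuples_def dest: in_set_takeD in_set_dropD)

lemma nuclear_bound_reshape:
  assumes sym: "sos_symmetric4 n M"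
    and M22: "schatten1_norm (to_mat n 2 2 M) \<le> 1"
    and M31: "schatten1_norm (to_mat n 3 1 (reshape M)) \<le> 1"
    and xy: "x + y = 4"
  shows "nuclear_bound (tuples n x) (tuples n y) (reshape M) 1"
proof -
  have M22: "nuclear_bound (tuples n 2) (tuples n 2) M 1"
    and M31: "nuclear_bound (tuples n 3) (tuples n 1) (reshape M) 1"
    using M22 M31 by (simp_all add: schatten1_norm_to_mat_le_iff)
  \<comment> \<open>Exchanging \<open>x\<close> and \<open>y\<close> amounts to transposition,
    because SoS-symmetry identifies the entries at \<open>I @ J\<close> and
    \<open>J @ I\<close>.\<close>
  have swap: "nuclear_bound (tuples n y) (tuples n x) (reshape M) 1"
    if "nuclear_bound (tuples n x) (tuples n y) (reshape M) 1" and "x + y = 4" for x y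
    using nuclear_bound_transpose[OF that(1)]
  proof (rule nuclear_bound_cong)
    fix J I assume "J \<in> tuples n y" "I \<in> tuples n x"
    then have "I @ J \<in> tuples n 4" "J @ I \<in> tuples n 4" using that(2) by (auto simp: tuples_def)
    then show "reshape M I J = reshape M J I"
      using sym unfolding sos_symmetric4_def reshape_def by (metis mset_append union_commute)
  qed
  have tuples_0: "tuples n 0 = {[]}" by (auto simp: tuples_def)
  have M40: "nuclear_bound (tuples n 4) (tuples n 0) (reshape M) 1"
  \<comment> \<open>A matrix with one column is a single rank-one term, whose weight is here the
    Frobenius norm of \<open>M\<close>.\<close>
  proof (rule nuclear_boundI[of "{()}" _ _ _ "\<lambda>_. tensor_of M" "\<lambda>_ _. 1"])
    have "L2_set (tensor_of M) (tuples n 4) = L2_set (\<lambda>p. tensor_of M (fst p @ snd p)) (tuples n 2 \<times> tuples n 2)"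
      using L2_set_reindex_bij_betw[OF bij_betw_append_tuples[of n 2 2], of "tensor_of M"]
      by (simp add: case_prod_unfold)
    also have "\<dots> = L2_set (\<lambda>(I, J). M I J) (tuples n 2 \<times> tuples n 2)"
      by (rule L2_set_cong) (auto simp: tensor_of_def tuples_def)
    also have "\<dots> \<le> 1" by (rule L2_set_le_nuclear_bound[OF M22])
    finally show "(\<Sum>i\<in>{()}. L2_set (tensor_of M) (tuples n 4) * L2_set (\<lambda>_. 1) (tuples n 0)) \<le> 1"
      by (simp add: tuples_0 L2_set_def)
  qed (auto simp: reshape_def tuples_def)
  have M22': "nuclear_bound (tuples n 2) (tuples n 2) (reshape M) 1"
    using M22 by (rule nuclear_bound_cong) (simp add: reshape_def tensor_of_def tuples_def)
  from xy consider "x = 0" "y = 4" | "x = 1" "y = 3" | "x = 2" "y = 2" | "x = 3" "y = 1" | "x = 4" "y = 0"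
    by linarith
  then show ?thesis
    by cases (use M40 M31 M22' swap[OF M40] swap[OF M31] in simp_all)
qed

section \<open>Kronecker powers under permutations of positions\<close>

lemma kronecker_power_eq_prod:
  assumes "length I = 2 * m" and "length J = 2 * m"
  shows "kronecker_power M m I J =
    (\<Prod>b<m. M [I ! (2 * b), I ! (2 * b + 1)] [J ! (2 * b), J ! (2 * b + 1)])"
  using assms
proof (induction m arbitrary: I J)
  case (Suc m)
  have "take 2 K = [K ! 0, K ! 1]" if "length K = 2 * Suc m" for K :: "nat list"
    using that by (cases K; cases "tl K") (auto simp: numeral_2_eq_2)
  moreover have "kronecker_power M m (drop 2 I) (drop 2 J) =
    (\<Prod>b<m. M [I ! (2 * Suc b), I ! (2 * Suc b + 1)] [J ! (2 * Suc b), J ! (2 * Suc b + 1)])"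
    using Suc.prems by (subst Suc.IH) simp_all
  ultimately show ?case
    unfolding prod.lessThan_Suc_shift using Suc.prems by (simp add: kronecker_def)
qed simp

text \<open>Positions, in the concatenation of row and column index, of the four indices of the \<open>b\<close>-th
  factor of the \<open>m\<close>-th Kronecker power.\<close>

definition kronecker_block :: "nat \<Rightarrow> nat \<Rightarrow> nat list" where
  "kronecker_block m b = [2 * b, 2 * b + 1, 2 * m + 2 * b, 2 * m + 2 * b + 1]"

lemma distinct_kronecker_block: "b < m \<Longrightarrow> distinct (kronecker_block m b)"
  by (auto simp: kronecker_block_def)

lemma disjoint_kronecker_block:
  "b < m \<Longrightarrow> c < m \<Longrightarrow> b \<noteq> c \<Longrightarrow> set (kronecker_block m b) \<inter> set (kronecker_block m c) = {}"
  by (auto simp: kronecker_block_def; presburger)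

lemma UN_kronecker_block: "(\<Union>b<m. set (kronecker_block m b)) = {..<4 * m}"
proof (intro equalityI subsetI)
  fix i assume "i \<in> {..<4 * m}"
  \<comment> \<open>Each factor owns two consecutive positions in the row half and two in the column
    half, which starts at \<open>2 * m\<close>.\<close>
  then have "(if i < 2 * m then i div 2 else (i - 2 * m) div 2) < m \<and>
      i \<in> set (kronecker_block m (if i < 2 * m then i div 2 else (i - 2 * m) div 2))"
    by (auto simp: kronecker_block_def; presburger)
  then show "i \<in> (\<Union>b<m. set (kronecker_block m b))" by blast
qed (auto simp: kronecker_block_def)

text \<open>After permuting, factor \<open>b\<close> reads the four positions
  \<open>map \<pi> (kronecker_block m b)\<close>. Sorting them into row and column positions turns
  the factor into a reshaping of \<open>M\<close> of norm at most 1, and distinct factors read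
  disjoint positions.\<close>

lemma nuclear_bound_permuted_kronecker_power:
  assumes sym: "sos_symmetric4 n M"
    and M22: "schatten1_norm (to_mat n 2 2 M) \<le> 1"
    and M31: "schatten1_norm (to_mat n 3 1 (reshape M)) \<le> 1"
    and pi: "\<pi> permutes {..<4 * m}"
  shows "nuclear_bound (tuples n (2 * m)) (tuples n (2 * m)) (permute_entries \<pi> (kronecker_power M m)) 1"
proof -
  let ?X = "\<lambda>_::nat. {..<n}"
  \<comment> \<open>\<open>r b\<close> and \<open>s b\<close> are the positions read by factor
    \<open>b\<close> that lie in the row index and in the column index. Their lengths vary with
    \<open>b\<close> but add up to 4.\<close>
  define r where "r b = filter (\<lambda>a. a < 2 * m) (map \<pi> (kronecker_block m b))" for b
  define s where "s b = filter (\<lambda>a. \<not> a < 2 * m) (map \<pi> (kronecker_block m b))" for b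
  have inj: "inj \<pi>" using permutes_inj[OF pi] .
  have dist: "distinct (r b)" "distinct (s b)" if "b < m" for b
    using distinct_kronecker_block[OF that] inj_on_subset[OF inj]
    by (auto simp: r_def s_def distinct_map intro!: distinct_filter)
  have len: "length (r b) + length (s b) = 4" for b
    unfolding r_def s_def sum_length_filter_compl by (simp add: kronecker_block_def)
  have disj: "set (map \<pi> (kronecker_block m b)) \<inter> set (map \<pi> (kronecker_block m c)) = {}"
    if "b < m" "c < m" "b \<noteq> c" for b c
    using disjoint_kronecker_block[OF that] by (simp add: image_Int[OF inj, symmetric])
  have cover: "(\<Union>b<m. set (map \<pi> (kronecker_block m b))) = {..<4 * m}"
    using UN_kronecker_block[of m] permutes_image[OF pi] by (simp flip: image_UN)
  have "set (r b) = set (map \<pi> (kronecker_block m b)) \<inter> {..<2 * m}" for b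
    by (auto simp: r_def)
  then have Ur: "(\<Union>b<m. set (r b)) = set [0..<2 * m]"
    using cover by auto
  have "set (s b) = set (map \<pi> (kronecker_block m b)) - {..<2 * m}" for b
    by (auto simp: s_def)
  then have Us: "(\<Union>b<m. set (s b)) = set [2 * m..<4 * m]"
    using cover by auto
  have "nuclear_bound (PiE (\<Union>b<m. set (r b)) ?X) (PiE (\<Union>b<m. set (s b)) ?X)
    (\<lambda>f g. \<Prod>b<m. reshape M (map (restrict f (set (r b))) (r b)) (map (restrict g (set (s b))) (s b))) 1"
  proof (rule nuclear_bound_prod_PiE[of _ _ _ _ "\<lambda>b f g. reshape M (map f (r b)) (map g (s b))"])
    show "disjoint_family_on (\<lambda>b. set (r b)) {..<m}" "disjoint_family_on (\<lambda>b. set (s b)) {..<m}"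
      using disj by (fastforce simp: disjoint_family_on_def r_def s_def)+
    show "nuclear_bound (PiE (set (r b)) ?X) (PiE (set (s b)) ?X) (\<lambda>f g. reshape M (map f (r b)) (map g (s b))) 1"
      if "b \<in> {..<m}" for b
      using nuclear_bound_reshape[OF sym M22 M31 len] dist that
      by (subst nuclear_bound_reindex[OF bij_betw_map_PiE bij_betw_map_PiE]) auto
  qed simp
  then have "nuclear_bound (PiE (set [0..<2 * m]) ?X) (PiE (set [2 * m..<4 * m]) ?X)
    (\<lambda>f g. permute_entries \<pi> (kronecker_power M m) (map f [0..<2 * m]) (map g [2 * m..<4 * m])) 1"
    unfolding Ur Us
  proof (rule nuclear_bound_cong)
    fix f g assume f: "f \<in> PiE (set [0..<2 * m]) ?X" and g: "g \<in> PiE (set [2 * m..<4 * m]) ?X"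
    \<comment> \<open>\<open>h\<close> glues the row and column functions into one multi-index on
      all \<open>4 * m\<close> positions, from which every factor reads.\<close>
    define h where "h a = (if a < 2 * m then f a else g a)" for a
    have h: "h a < n" if "a < 4 * m" for a
      using f g that by (auto simp: h_def PiE_iff)
    have fg: "map f [0..<2 * m] @ map g [2 * m..<4 * m] = map h [0..<4 * m]"
      by (rule nth_equalityI) (auto simp: nth_append h_def)
    have perm: "permute_list \<pi> (map h [0..<4 * m]) = map (\<lambda>i. h (\<pi> i)) [0..<4 * m]"
      using permutes_in_image[OF pi] by (auto simp: permute_list_def)
    have "permute_entries \<pi> (kronecker_power M m) (map f [0..<2 * m]) (map g [2 * m..<4 * m])
        = kronecker_power M m (map (\<lambda>i. h (\<pi> i)) [0..<2 * m]) (map (\<lambda>i. h (\<pi> i)) [2 * m..<4 * m])"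
      unfolding permute_entries_def fg perm by (simp add: take_map drop_map)
    also have "\<dots> = (\<Prod>b<m. M [h (\<pi> (2 * b)), h (\<pi> (2 * b + 1))]
        [h (\<pi> (2 * m + 2 * b)), h (\<pi> (2 * m + 2 * b + 1))])"
      by (subst kronecker_power_eq_prod) (auto intro!: prod.cong)
    also have "\<dots> = (\<Prod>b<m. tensor_of M (map h (map \<pi> (kronecker_block m b))))"
      by (simp add: tensor_of_def kronecker_block_def)
    also have "\<dots> = (\<Prod>b<m. reshape M (map (restrict f (set (r b))) (r b)) (map (restrict g (set (s b))) (s b)))"
    proof (rule prod.cong[OF refl])
      fix b assume b: "b \<in> {..<m}"
      let ?as = "map \<pi> (kronecker_block m b)"
      have rs: "map (restrict f (set (r b))) (r b) = map h (r b)"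
        "map (restrict g (set (s b))) (s b) = map h (s b)"
        by (auto simp: h_def r_def s_def)
      \<comment> \<open>Filtering only reorders the four positions, so SoS-symmetry lets row
        positions come before column positions.\<close>
      have mset_rs: "mset (r b @ s b) = mset ?as" by (simp add: r_def s_def)
      have "set ?as \<subseteq> {..<4 * m}" using cover b by blast
      then have "map h ?as \<in> tuples n 4" using h by (auto simp: tuples_def kronecker_block_def)
      moreover have "set (r b @ s b) \<subseteq> {..<4 * m}"
        using \<open>set ?as \<subseteq> {..<4 * m}\<close> mset_eq_setD[OF mset_rs] by simp
      then have "map h (r b @ s b) \<in> tuples n 4"
        using h len[of b] by (auto simp: tuples_def subset_iff)
      moreover have "mset (map h ?as) = mset (map h (r b @ s b))"
        by (simp only: mset_map mset_rs)
      ultimately show "tensor_of M (map h ?as) = reshape M (map (restrict f (set (r b))) (r b)) (map (restrict g (set (s b))) (s b))"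
        using sym unfolding rs reshape_def sos_symmetric4_def by (metis map_append)
    qed
    finally show "(\<Prod>b<m. reshape M (map (restrict f (set (r b))) (r b)) (map (restrict g (set (s b))) (s b)))
      = permute_entries \<pi> (kronecker_power M m) (map f [0..<2 * m]) (map g [2 * m..<4 * m])" ..
  qed
  then have "nuclear_bound (tuples n (length [0..<2 * m])) (tuples n (length [2 * m..<4 * m]))
      (permute_entries \<pi> (kronecker_power M m)) 1"
    by (subst (asm) nuclear_bound_reindex[OF bij_betw_map_PiE bij_betw_map_PiE]) auto
  then show ?thesis by simp
qed

lemma schatten1_norm_symmetrized_kronecker_power_le_1:
  assumes "sos_symmetric4 n M"
    and "schatten1_norm (to_mat n 2 2 M) \<le> 1"
    and "schatten1_norm (to_mat n 3 1 (reshape M)) \<le> 1"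
  shows "schatten1_norm (to_mat n (2 * m) (2 * m) (symmetrization (4 * m) (kronecker_power M m))) \<le> 1"
proof -
  let ?S = "{\<pi>. \<pi> permutes {..<4 * m}}"
  have "nuclear_bound (tuples n (2 * m)) (tuples n (2 * m))
      (\<lambda>I J. \<Sum>\<pi>\<in>?S. permute_entries \<pi> (kronecker_power M m) I J) (\<Sum>\<pi>\<in>?S. 1)"
    using nuclear_bound_permuted_kronecker_power[OF assms]
    by (intro nuclear_bound_sum finite_permutations) auto
  then have "nuclear_bound (tuples n (2 * m)) (tuples n (2 * m))
      (\<lambda>I J. 1 / fact (4 * m) * (\<Sum>\<pi>\<in>?S. permute_entries \<pi> (kronecker_power M m) I J))
      (1 / fact (4 * m) * (\<Sum>\<pi>\<in>?S. 1))"
    by (rule nuclear_bound_scale) simp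
  \<comment> \<open>The number of permutations is \<open>fact (4 * m)\<close>, so averaging bounds
    of 1 gives 1.\<close>
  also have "1 / fact (4 * m) * (\<Sum>\<pi>\<in>?S. 1) = (1::real)"
    using card_permutations[of "{..<4 * m}" "4 * m"] by simp
  finally have "nuclear_bound (tuples n (2 * m)) (tuples n (2 * m))
      (symmetrization (4 * m) (kronecker_power M m)) 1"
    by (rule nuclear_bound_cong) (simp add: symmetrization_def)
  then show ?thesis by (simp add: schatten1_norm_to_mat_le_iff)
qed

theorem theorem8p1:
  shows "\<exists>C::real. \<forall>(n::nat) (M::tmatrix) (q::nat).
    sos_symmetric4 n M \<longrightarrow>
    schatten1_norm (to_mat n 2 2 M) \<le> 1 \<longrightarrow>
    schatten1_norm (to_mat n 3 1 (reshape M)) \<le> 1 \<longrightarrow>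
    4 dvd q \<longrightarrow>
    schatten1_norm
      (to_mat n (q div 2) (q div 2) (symmetrization q (kronecker_power M (q div 4))))
    \<le> 2 powr (C * real q)"
proof (intro exI[of _ 0] allI impI)
  fix n M and q :: nat
  assume M: "sos_symmetric4 n M" "schatten1_norm (to_mat n 2 2 M) \<le> 1"
    "schatten1_norm (to_mat n 3 1 (reshape M)) \<le> 1" and "4 dvd q"
  then obtain m where q: "q = 4 * m" by auto
  then have "q div 2 = 2 * m" "q div 4 = m" by auto
  then show "schatten1_norm (to_mat n (q div 2) (q div 2) (symmetrization q (kronecker_power M (q div 4))))
      \<le> 2 powr (0 * real q)"
    using schatten1_norm_symmetrized_kronecker_power_le_1[OF M, of m] by (simp add: q)
qed

end
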